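(* Let $g_1,f_1,g_2,f_2\in\mathcal{F}_0$. Then $$\{g_1,f_1\}\cdot\{g_2,f_2\}=\left\{g_1\left(\frac{x}{f_2(x)}\right)g_2(x),\ \frac{x}{\left(\frac{x}{f_1(x)}\right)\circ\left(\frac{x}{f_2(x)}\right)}\right\}.$$
   Context: All power series are formal power series in $x$ with coefficients in $\mathbb{Q}$. $\mathcal{F}_0$ is the set of series $a_0+a_1x+a_2x^2+\cdots$ with $a_0\neq 0$; $\mathcal{F}_1$ is the set of series $a_1x+a_2x^2+\cdots$ with $a_1\ne 0$. $[x^m]$ extracts the coefficient of $x^m$ (and is $0$ for $m<0$). For $g,f\in\mathcal{F}_0$, $\{g,f\}$ denotes the infinite lower-triangular matrix, indexed by $n,k\ge0$, with $(n,k)$ entry $[x^{n-k}]\,g(x)f(x)^n$. The product $\cdot$ is matrix multiplication. $\circ$ denotes composition of power series: $(a\circ b)(x)=a(b(x))$. The quotient $x/w$ for $w\in\mathcal{F}_1$ is understood as a power series after cancelling the factor $x$. *)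

theory Defs
  imports
    "HOL-Computational_Algebra.Formal_Power_Series"
    "HOL-Library.Groups_Big_Fun"
begin

unbundle fps_syntax

definition F0 :: "rat fps set"
  where "F0 = {f. f $ 0 \<noteq> 0}"

definition F1 :: "rat fps set"
  where "F1 = {f. f $ 0 = 0 \<and> f $ 1 \<noteq> 0}"

type_synonym inf_matrix = "nat \<Rightarrow> nat \<Rightarrow> rat"

(* The matrix written {g, f}, row index first. The case distinction is the convention
   that coefficients at negative powers vanish: n - k truncates on nat. *)
definition coeff_matrix :: "rat fps \<Rightarrow> rat fps \<Rightarrow> inf_matrix"
  where "coeff_matrix g f = (\<lambda>n k. if k \<le> n then (g * f ^ n) $ (n - k) else 0)"

(* Sum_any sums a finitely supported family over all indices; it is 0 by convention when
   the support is infinite, which does not happen for lower-triangular A. *)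
definition inf_matrix_mult :: "inf_matrix \<Rightarrow> inf_matrix \<Rightarrow> inf_matrix"  (infixl "\<cdot>\<^sub>M" 70)
  where "A \<cdot>\<^sub>M B = (\<lambda>n k. Sum_any (\<lambda>j. A n j * B j k))"

(* The quotients and compositions used below are genuine: fps_compose has its intended
   meaning when the inner series has zero constant term, and division of fps_X by a
   series in F1 cancels the common factor fps_X. *)

lemma finite_support_coeff_matrix_mult:
  "finite {j. coeff_matrix g f n j * B j k \<noteq> 0}"
  by (rule finite_subset[of _ "{..n}"]) (auto simp: coeff_matrix_def split: if_splits)

lemma fps_X_divide_F0:
  assumes "f \<in> F0"
  shows "fps_X / f \<in> F1" and "fps_X / f * f = fps_X"
proof -
  have *: "fps_X / f = fps_X * inverse f"
    using assms by (simp add: F0_def fps_divide_unit)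
  show "fps_X / f \<in> F1"
    using assms by (simp add: * F0_def F1_def)
  show "fps_X / f * f = fps_X"
    using assms by (simp add: * F0_def mult.assoc inverse_mult_eq_1)
qed

lemma fps_compose_F1:
  assumes "v \<in> F1" and "w \<in> F1"
  shows "v oo w \<in> F1"
  using assms by (simp add: F1_def fps_compose_nth)

lemma fps_X_divide_F1:
  assumes "w \<in> F1"
  shows "fps_X / w \<in> F0" and "fps_X / w * w = fps_X"
proof -
  have sd: "subdegree w = 1"
    using assms by (intro subdegreeI) (auto simp: F1_def)
  then have "w dvd fps_X"
    by (subst fps_dvd_iff) (use assms in \<open>auto simp: F1_def\<close>)
  then show eq: "fps_X / w * w = fps_X"
    by simp
  have "(fps_X / w * w) $ 1 = (fps_X / w) $ 0 * w $ 1"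
    using assms by (simp add: fps_mult_nth F1_def del: dvd_div_mult_self)
  then show "fps_X / w \<in> F0"
    unfolding eq by (auto simp: F0_def)
qed

end

theory Submission
  imports Defs
begin

text \<open>
  With \<open>v = x / f2\<close> the second series on the right-hand side is \<open>f2 \<cdot> (f1 \<circ> v)\<close>, so both sides
  depend on \<open>g1\<close> and \<open>f1\<close> only through \<open>h = g1 \<cdot> f1^n\<close>. The right-hand side is then the coefficient of
  \<open>x^(n-k)\<close> in \<open>(h \<circ> v) \<cdot> g2 \<cdot> f2^n\<close>; expanding \<open>h\<close> and using \<open>v^i \<cdot> f2^n = x^i \<cdot> f2^(n-i)\<close> gives
  the matrix product, summed over \<open>j = n - i\<close>.
\<close>

text \<open>As \<open>b\<close> has no constant term, \<open>b ^ i\<close> starts at degree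
  \<open>i\<close> or later, so one bound \<open>m\<close> serves all the inner sums and the two
  summations can be swapped.\<close>

lemma fps_compose_mult_nth:
  fixes a b p :: "'a::comm_ring_1 fps"
  assumes "b $ 0 = 0"
  shows "((a oo b) * p) $ m = (\<Sum>i=0..m. a $ i * (b ^ i * p) $ m)"
proof -
  have "((a oo b) * p) $ m = (\<Sum>l=0..m. (\<Sum>i=0..l. a $ i * (b ^ i) $ l) * p $ (m - l))"
    by (simp add: fps_mult_nth fps_compose_nth)
  also have "\<dots> = (\<Sum>l=0..m. (\<Sum>i=0..m. a $ i * (b ^ i) $ l) * p $ (m - l))"
  proof (rule sum.cong[OF refl])
    fix l assume "l \<in> {0..m}"
    then have "(\<Sum>i=0..l. a $ i * (b ^ i) $ l) = (\<Sum>i=0..m. a $ i * (b ^ i) $ l)"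
      using startsby_zero_power_prefix[OF assms] by (intro sum.mono_neutral_left) auto
    then show "(\<Sum>i=0..l. a $ i * (b ^ i) $ l) * p $ (m - l)
        = (\<Sum>i=0..m. a $ i * (b ^ i) $ l) * p $ (m - l)"
      by simp
  qed
  also have "\<dots> = (\<Sum>i=0..m. \<Sum>l=0..m. a $ i * (b ^ i) $ l * p $ (m - l))"
    by (subst sum.swap) (simp add: sum_distrib_right)
  also have "\<dots> = (\<Sum>i=0..m. a $ i * (b ^ i * p) $ m)"
    by (simp add: fps_mult_nth sum_distrib_left mult.assoc)
  finally show ?thesis .
qed

text \<open>Removes the nested quotient: composing \<open>fps_X / f1 * f1 = fps_X\<close> with
  \<open>v\<close> and multiplying by \<open>f2\<close> turns the right side into
  \<open>v * f2 = fps_X\<close>.\<close>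

lemma fps_X_divide_compose_F1:
  assumes "f1 \<in> F0" and "f2 \<in> F0"
  defines "v \<equiv> fps_X / f2"
  shows "fps_X / ((fps_X / f1) oo v) = f2 * (f1 oo v)"
proof -
  let ?w = "(fps_X / f1) oo v"
  have v: "v \<in> F1" "v * f2 = fps_X"
    using fps_X_divide_F0[OF assms(2)] by (simp_all add: v_def)
  have v0: "v $ 0 = 0"
    using v(1) by (simp add: F1_def)
  have w: "?w \<in> F1"
    using fps_compose_F1 fps_X_divide_F0(1)[OF assms(1)] v(1) by blast
  have "?w * (f1 oo v) = v"
    using fps_X_divide_F0(2)[OF assms(1)] v0
    by (simp add: fps_compose_mult_distrib[symmetric] del: dvd_div_mult_self)
  then have "f2 * (f1 oo v) * ?w = fps_X / ?w * ?w"
    using v(2) fps_X_divide_F1(2)[OF w] by (simp add: mult_ac del: dvd_div_mult_self)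
  \<comment> \<open>Both products with \<open>?w\<close> equal \<open>fps_X\<close>, so
    \<open>?w\<close> can be cancelled.\<close>
  moreover have "?w \<noteq> 0"
    using w by (auto simp: F1_def)
  ultimately show ?thesis
    by (metis mult_right_cancel)
qed

lemma coeff_matrix_compose:
  assumes "v $ 0 = 0" and vf: "v * f = fps_X"
  shows "coeff_matrix ((g oo v) * p) (f * (u oo v)) n k
    = (\<Sum>j\<le>n. coeff_matrix g u n j * coeff_matrix p f j k)"
proof (cases "k \<le> n")
  case True
  have shift: "v ^ i * (p * f ^ n) = fps_X ^ i * (p * f ^ (n - i))" if "i \<le> n" for i
    using that by (simp add: vf[symmetric] power_mult_distrib mult_ac flip: power_add)
  let ?h = "g * u ^ n"
  have "coeff_matrix ((g oo v) * p) (f * (u oo v)) n k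
      = ((?h oo v) * (p * f ^ n)) $ (n - k)"
    using True assms(1)
    by (simp add: coeff_matrix_def fps_compose_mult_distrib fps_compose_power
        power_mult_distrib mult_ac)
  also have "\<dots> = (\<Sum>i=0..n-k. ?h $ i * (v ^ i * (p * f ^ n)) $ (n - k))"
    by (rule fps_compose_mult_nth[OF assms(1)])
  \<comment> \<open>Here \<open>i \<le> n - k\<close>, so neither \<open>n - i\<close> nor
    \<open>n - k - i\<close> truncates.\<close>
  also have "\<dots> = (\<Sum>i=0..n-k. ?h $ i * (p * f ^ (n - i)) $ (n - k - i))"
    by (intro sum.cong refl) (simp add: shift fps_X_power_mult_nth)
  also have "\<dots> = (\<Sum>j=k..n. ?h $ (n - j) * (p * f ^ j) $ (j - k))"
    using True
    by (intro sum.reindex_bij_witness[of _ "\<lambda>j. n - j" "\<lambda>i. n - i"])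
       (auto simp: add.commute)
  \<comment> \<open>The added terms \<open>j < k\<close> lie above the diagonal of the second
    matrix.\<close>
  also have "\<dots> = (\<Sum>j\<le>n. coeff_matrix g u n j * coeff_matrix p f j k)"
    by (intro sum.mono_neutral_cong_left) (auto simp: coeff_matrix_def)
  finally show ?thesis .
\<comment> \<open>For \<open>n < k\<close>, every \<open>j \<le> n\<close> is below
  \<open>k\<close>, so both sides are 0.\<close>
qed (auto simp: coeff_matrix_def intro!: sum.neutral)

theorem proposition19:
  fixes g1 f1 g2 f2 :: "rat fps"
  assumes "g1 \<in> F0" and "f1 \<in> F0" and "g2 \<in> F0" and "f2 \<in> F0"
  shows "coeff_matrix g1 f1 \<cdot>\<^sub>M coeff_matrix g2 f2 =
    coeff_matrix ((g1 oo (fps_X / f2)) * g2)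
      (fps_X / ((fps_X / f1) oo (fps_X / f2)))"
proof (intro ext)
  fix n k
  let ?v = "fps_X / f2"
  have v: "?v $ 0 = 0" "?v * f2 = fps_X"
    using fps_X_divide_F0[OF assms(4)] by (auto simp: F1_def)
  \<comment> \<open>Row \<open>n\<close> of the first matrix vanishes beyond \<open>j = n\<close>,
    which makes the sum finite.\<close>
  have "(coeff_matrix g1 f1 \<cdot>\<^sub>M coeff_matrix g2 f2) n k
      = (\<Sum>j\<le>n. coeff_matrix g1 f1 n j * coeff_matrix g2 f2 j k)"
    unfolding inf_matrix_mult_def
    by (intro Sum_any.expand_superset) (auto simp: coeff_matrix_def split: if_splits)
  then show "(coeff_matrix g1 f1 \<cdot>\<^sub>M coeff_matrix g2 f2) n k
      = coeff_matrix ((g1 oo ?v) * g2) (fps_X / ((fps_X / f1) oo ?v)) n k"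
    using coeff_matrix_compose[OF v] fps_X_divide_compose_F1[OF assms(2,4)] by simp
qed

end
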